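(* Property $D_\alpha$ is a coarse invariant of box spaces. That is, let $\alpha\in(0,1]$, let $G,H$ be finitely generated, residually finite groups with filtrations $(M_k)_{k>0}$ of $G$ and $(N_k)_{k>0}$ of $H$, and suppose that $\square_{(M_k)}G$ and $\square_{(N_k)}H$ are coarsely equivalent. If $\square_{(M_k)}G$ has property $D_\alpha$, then $\square_{(N_k)}H$ has property $D_\alpha$.
   Context: A map $f:X\to Y$ of metric spaces is a coarse embedding if for all sequences $(x_n),(y_n)$ in $X$: $d_X(x_n,y_n)\to+\infty \iff d_Y(f(x_n),f(y_n))\to +\infty$. It is a coarse equivalence if moreover there is $R\ge 0$ such that $Y$ is the $R$-neighbourhood of $f(X)$. A filtration of a finitely generated residually finite group $G$ is a decreasing sequence $(M_k)_{k>0}$ of finite index normal subgroups of $G$ with trivial intersection. Fix a finite generating set $S$ of $G$ and view each $G/M_k$ as a Cayley graph (with its word metric) with respect to $S$. The box space $\square_{(M_k)}G$ is the coarse disjoint union of the components $G/M_k$, i.e. their disjoint union with a metric inducing the word metric on each component and with the distance between two different components at least the maximum of their diameters. For $\alpha\in(0,1]$, $\square_{(M_k)}G$ has property $D_\alpha$ if there exists $K>0$ (only depending on $S$) such that $\mathrm{diam}(G/M)\ge K\,|G/M|^\alpha$ for every component $G/M$ of $\square_{(M_k)}G$.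
   Formalization: Property D_α is required only of components with more than one point (a one-point component has diameter 0 and always fails), and box-space metrics must have distances between distinct components tending to infinity, which is automatic for infinite groups. *)

theory Defs
  imports "HOL-Analysis.Abstract_Metric_Spaces" "HOL-Algebra.Generated_Groups"
begin

section \<open>Coarse maps\<close>

definition coarse_embedding ::
  "'a set \<Rightarrow> ('a \<Rightarrow> 'a \<Rightarrow> real) \<Rightarrow> 'b set \<Rightarrow> ('b \<Rightarrow> 'b \<Rightarrow> real) \<Rightarrow> ('a \<Rightarrow> 'b) \<Rightarrow> bool" where
  "coarse_embedding X dX Y dY f \<longleftrightarrow>
     f \<in> X \<rightarrow> Y \<and>
     (\<forall>x y :: nat \<Rightarrow> 'a. (\<forall>n. x n \<in> X) \<longrightarrow> (\<forall>n. y n \<in> X) \<longrightarrow>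
        (filterlim (\<lambda>n. dX (x n) (y n)) at_top sequentially \<longleftrightarrow>
         filterlim (\<lambda>n. dY (f (x n)) (f (y n))) at_top sequentially))"

definition coarse_equivalence ::
  "'a set \<Rightarrow> ('a \<Rightarrow> 'a \<Rightarrow> real) \<Rightarrow> 'b set \<Rightarrow> ('b \<Rightarrow> 'b \<Rightarrow> real) \<Rightarrow> ('a \<Rightarrow> 'b) \<Rightarrow> bool" where
  "coarse_equivalence X dX Y dY f \<longleftrightarrow>
     coarse_embedding X dX Y dY f \<and>
     (\<exists>R\<ge>0. \<forall>y\<in>Y. \<exists>x\<in>X. dY (f x) y \<le> R)"

definition coarsely_equivalent ::
  "'a set \<Rightarrow> ('a \<Rightarrow> 'a \<Rightarrow> real) \<Rightarrow> 'b set \<Rightarrow> ('b \<Rightarrow> 'b \<Rightarrow> real) \<Rightarrow> bool" where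
  "coarsely_equivalent X dX Y dY \<longleftrightarrow> (\<exists>f. coarse_equivalence X dX Y dY f)"

section \<open>Groups, filtrations and word metrics\<close>

definition finite_generating_set :: "('a, 'm) monoid_scheme \<Rightarrow> 'a set \<Rightarrow> bool" where
  "finite_generating_set G S \<longleftrightarrow> finite S \<and> S \<subseteq> carrier G \<and> generate G S = carrier G"

definition residually_finite :: "('a, 'm) monoid_scheme \<Rightarrow> bool" where
  "residually_finite G \<longleftrightarrow>
     (\<forall>g\<in>carrier G. g \<noteq> \<one>\<^bsub>G\<^esub> \<longrightarrow> (\<exists>N. N \<lhd> G \<and> finite (rcosets\<^bsub>G\<^esub> N) \<and> g \<notin> N))"

definition filtration :: "('a, 'm) monoid_scheme \<Rightarrow> (nat \<Rightarrow> 'a set) \<Rightarrow> bool" where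
  "filtration G M \<longleftrightarrow>
     (\<forall>k>0. M k \<lhd> G \<and> finite (rcosets\<^bsub>G\<^esub> (M k))) \<and>
     (\<forall>i j. 0 < i \<and> i \<le> j \<longrightarrow> M j \<subseteq> M i) \<and>
     (\<Inter>k\<in>{0<..}. M k) = {\<one>\<^bsub>G\<^esub>}"

definition cayley_edges :: "('a, 'm) monoid_scheme \<Rightarrow> 'a set \<Rightarrow> ('a \<times> 'a) set" where
  "cayley_edges Q S = {(x, x \<otimes>\<^bsub>Q\<^esub> s) | x s. x \<in> carrier Q \<and> s \<in> S}"

text \<open>The path metric of the (undirected) Cayley graph.\<close>

definition word_dist :: "('a, 'm) monoid_scheme \<Rightarrow> 'a set \<Rightarrow> 'a \<Rightarrow> 'a \<Rightarrow> nat" where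
  "word_dist Q S x y = (LEAST n. (x, y) \<in> (cayley_edges Q S \<union> (cayley_edges Q S)\<inverse>) ^^ n)"

definition quotient_gens :: "('a, 'm) monoid_scheme \<Rightarrow> 'a set \<Rightarrow> 'a set \<Rightarrow> 'a set set" where
  "quotient_gens G N S = (\<lambda>s. N #>\<^bsub>G\<^esub> s) ` S"

definition quotient_dist :: "('a, 'm) monoid_scheme \<Rightarrow> 'a set \<Rightarrow> 'a set \<Rightarrow> 'a set \<Rightarrow> 'a set \<Rightarrow> nat" where
  "quotient_dist G S N = word_dist (G Mod N) (quotient_gens G N S)"

definition quotient_diam :: "('a, 'm) monoid_scheme \<Rightarrow> 'a set \<Rightarrow> 'a set \<Rightarrow> nat" where
  "quotient_diam G S N =
     Max {quotient_dist G S N x y | x y. x \<in> carrier (G Mod N) \<and> y \<in> carrier (G Mod N)}"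

section \<open>Box spaces\<close>

definition box_points :: "('a, 'm) monoid_scheme \<Rightarrow> (nat \<Rightarrow> 'a set) \<Rightarrow> (nat \<times> 'a set) set" where
  "box_points G M = (SIGMA k:{0<..}. carrier (G Mod M k))"

definition disjoint_union_metric ::
  "('a, 'm) monoid_scheme \<Rightarrow> 'a set \<Rightarrow> (nat \<Rightarrow> 'a set) \<Rightarrow>
   (nat \<times> 'a set \<Rightarrow> nat \<times> 'a set \<Rightarrow> real) \<Rightarrow> bool" where
  "disjoint_union_metric G S M d \<longleftrightarrow>
     Metric_space (box_points G M) d \<and>
     (\<forall>k>0. \<forall>x\<in>carrier (G Mod M k). \<forall>y\<in>carrier (G Mod M k).
        d (k, x) (k, y) = real (quotient_dist G S (M k) x y)) \<and>
     (\<forall>i>0. \<forall>j>0. i \<noteq> j \<longrightarrow>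
        (\<forall>x\<in>carrier (G Mod M i). \<forall>y\<in>carrier (G Mod M j).
           d (i, x) (j, y) \<ge> real (max (quotient_diam G S (M i)) (quotient_diam G S (M j)))))"

definition components_separated ::
  "('a, 'm) monoid_scheme \<Rightarrow> (nat \<Rightarrow> 'a set) \<Rightarrow>
   (nat \<times> 'a set \<Rightarrow> nat \<times> 'a set \<Rightarrow> real) \<Rightarrow> bool" where
  "components_separated G M d \<longleftrightarrow>
     (\<forall>r. finite {(i, j). 0 < i \<and> 0 < j \<and> i \<noteq> j \<and>
        (\<exists>x\<in>carrier (G Mod M i). \<exists>y\<in>carrier (G Mod M j). d (i, x) (j, y) \<le> r)})"

text \<open>
  In a coarse disjoint union the distance between distinct components tends to infinity. For
  infinite G this follows from the lower bound by the diameters, so that the second conjunct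
  below is redundant (lemma \<open>box_metric_iff_disjoint_union_metric\<close>). It matters only for
  finite G, where the diameters are bounded and the lower bound alone would allow, for instance,
  every metric on the positive integers as a box space of the trivial group.
\<close>

definition box_metric ::
  "('a, 'm) monoid_scheme \<Rightarrow> 'a set \<Rightarrow> (nat \<Rightarrow> 'a set) \<Rightarrow>
   (nat \<times> 'a set \<Rightarrow> nat \<times> 'a set \<Rightarrow> real) \<Rightarrow> bool" where
  "box_metric G S M d \<longleftrightarrow> disjoint_union_metric G S M d \<and> components_separated G M d"

text \<open>
  One-point components are left out: they have diameter 0 and cardinality 1, so the inequality
  fails for them whatever K is. A filtration with first term G could then never have the property,
  although dropping that term changes the box space by one point only.
\<close>

definition property_D ::
  "real \<Rightarrow> ('a, 'm) monoid_scheme \<Rightarrow> 'a set \<Rightarrow> (nat \<Rightarrow> 'a set) \<Rightarrow> bool" where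
  "property_D \<alpha> G S M \<longleftrightarrow>
     (\<exists>K>0. \<forall>k>0. order (G Mod M k) \<noteq> 1 \<longrightarrow>
        real (quotient_diam G S (M k)) \<ge> K * real (order (G Mod M k)) powr \<alpha>)"

section \<open>Separation of components for infinite groups\<close>

lemma cayley_connected:
  fixes Q (structure)
  assumes "group Q" "S \<subseteq> carrier Q" "g \<in> generate Q S" "x \<in> carrier Q"
  shows "(x, x \<otimes> g) \<in> (cayley_edges Q S \<union> (cayley_edges Q S)\<inverse>)\<^sup>*"
proof -
  interpret group Q by fact
  show ?thesis
    using assms(3,4)
  proof (induction arbitrary: x rule: generate.induct)
    case one
    then show ?case by simp
  next
    case (incl h)
    then have "(x, x \<otimes> h) \<in> cayley_edges Q S" unfolding cayley_edges_def by blast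
    then show ?case by blast
  next
    case (inv h)
    then have h: "h \<in> carrier Q" using assms(2) by auto
    then have "(x \<otimes> inv h) \<otimes> h = x" using inv by (simp add: m_assoc)
    then have "(x \<otimes> inv h, x) \<in> cayley_edges Q S"
      unfolding cayley_edges_def using inv h
      by (intro CollectI exI[of _ "x \<otimes> inv h"] exI[of _ h]) simp
    then show ?case by blast
  next
    case (eng h1 h2)
    have c: "h1 \<in> carrier Q" "h2 \<in> carrier Q"
      using eng.hyps generate_in_carrier[OF assms(2)] by auto
    have "(x, x \<otimes> h1) \<in> (cayley_edges Q S \<union> (cayley_edges Q S)\<inverse>)\<^sup>*"
      "(x \<otimes> h1, (x \<otimes> h1) \<otimes> h2) \<in> (cayley_edges Q S \<union> (cayley_edges Q S)\<inverse>)\<^sup>*"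
      using eng.IH eng.prems c by simp_all
    then have "(x, (x \<otimes> h1) \<otimes> h2) \<in> (cayley_edges Q S \<union> (cayley_edges Q S)\<inverse>)\<^sup>*"
      by (rule rtrancl_trans)
    then show ?case using c eng.prems by (simp add: m_assoc)
  qed
qed

lemma cayley_ball:
  fixes Q (structure)
  assumes "group Q" "S \<subseteq> carrier Q" "finite S" "x \<in> carrier Q"
  shows "finite ({y. (x, y) \<in> (cayley_edges Q S \<union> (cayley_edges Q S)\<inverse>) ^^ n}) \<and>
    {y. (x, y) \<in> (cayley_edges Q S \<union> (cayley_edges Q S)\<inverse>) ^^ n} \<subseteq> carrier Q \<and>
    card ({y. (x, y) \<in> (cayley_edges Q S \<union> (cayley_edges Q S)\<inverse>) ^^ n}) \<le> (2 * card S) ^ n"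
proof -
  interpret group Q by fact
  define R where "R = cayley_edges Q S \<union> (cayley_edges Q S)\<inverse>"
  define A where "A n = {y. (x, y) \<in> R ^^ n}" for n
  define f where "f = (\<lambda>(y, b, s). if b then y \<otimes> s else y \<otimes> inv s)"
  have step: "A (Suc n) \<subseteq> f ` (A n \<times> UNIV \<times> S)" for n
  proof
    fix z assume "z \<in> A (Suc n)"
    then have "(x, z) \<in> R ^^ n O R" by (simp add: A_def)
    then obtain y where y: "y \<in> A n" "(y, z) \<in> R" unfolding A_def by blast
    have "\<exists>b. \<exists>s\<in>S. z = f (y, b, s)"
    proof (cases "(y, z) \<in> cayley_edges Q S")
      case True
      then obtain s where "s \<in> S" "z = y \<otimes> s" unfolding cayley_edges_def by blast
      then have "z = f (y, True, s)" by (simp add: f_def)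
      then show ?thesis using \<open>s \<in> S\<close> by blast
    next
      case False
      then have "(z, y) \<in> cayley_edges Q S" using y(2) unfolding R_def by blast
      then obtain s where s: "s \<in> S" "y = z \<otimes> s" "z \<in> carrier Q"
        unfolding cayley_edges_def by blast
      then have "s \<in> carrier Q" using assms(2) by blast
      then have "z = f (y, False, s)" using s(2,3) by (simp add: f_def m_assoc)
      then show ?thesis using s(1) by blast
    qed
    then show "z \<in> f ` (A n \<times> UNIV \<times> S)" using y(1) by blast
  qed
  have "finite (A n) \<and> A n \<subseteq> carrier Q \<and> card (A n) \<le> (2 * card S) ^ n"
  proof (induction n)
    case 0
    then show ?case using assms(4) by (simp add: A_def)
  next
    case (Suc n)
    have fin: "finite (A n \<times> (UNIV :: bool set) \<times> S)" using Suc assms(3) by simp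
    have "card (A (Suc n)) \<le> card (A n \<times> (UNIV :: bool set) \<times> S)"
      by (rule order_trans[OF card_mono[OF finite_imageI[OF fin] step] card_image_le[OF fin]])
    also have "\<dots> = card (A n) * (2 * card S)" by (simp add: card_cartesian_product)
    also have "\<dots> \<le> (2 * card S) ^ n * (2 * card S)"
      using conjunct2[OF conjunct2[OF Suc]] by (rule mult_right_mono) simp
    finally have c: "card (A (Suc n)) \<le> (2 * card S) ^ Suc n" by (simp add: mult.commute)
    have "f ` (A n \<times> UNIV \<times> S) \<subseteq> carrier Q"
    proof (rule image_subsetI)
      fix p assume p: "p \<in> A n \<times> (UNIV :: bool set) \<times> S"
      obtain y b s where ybs: "p = (y, b, s)" by (cases p)
      have "y \<in> carrier Q" "s \<in> carrier Q" using p ybs Suc assms(2) by blast+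
      then show "f p \<in> carrier Q" by (simp add: f_def ybs)
    qed
    then have "A (Suc n) \<subseteq> carrier Q" using step by (rule order_trans[rotated])
    then show ?case
      using c finite_subset[OF step finite_imageI[OF fin]] by simp
  qed
  then show ?thesis by (simp add: A_def R_def)
qed

lemma order_le_word_bound:
  fixes Q (structure)
  assumes "group Q" "S \<subseteq> carrier Q" "finite S" "generate Q S = carrier Q"
    and D: "\<And>y. y \<in> carrier Q \<Longrightarrow> word_dist Q S \<one> y \<le> D"
  shows "order Q \<le> (\<Sum>n\<le>D. (2 * card S) ^ n)"
proof -
  interpret group Q by fact
  let ?R = "cayley_edges Q S \<union> (cayley_edges Q S)\<inverse>"
  let ?A = "\<lambda>n. {y. (\<one>, y) \<in> ?R ^^ n}"
  have sub: "carrier Q \<subseteq> (\<Union>n\<le>D. ?A n)"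
  proof
    fix y assume y: "y \<in> carrier Q"
    then have "(\<one>, y) \<in> ?R\<^sup>*" using cayley_connected[OF assms(1,2), of y \<one>] assms(4) by simp
    then have "\<exists>n. (\<one>, y) \<in> ?R ^^ n" using rtrancl_imp_relpow by blast
    then have "(\<one>, y) \<in> ?R ^^ word_dist Q S \<one> y" unfolding word_dist_def by (rule LeastI_ex)
    then show "y \<in> (\<Union>n\<le>D. ?A n)" using D[OF y] by auto
  qed
  have ball: "finite (?A n)" "card (?A n) \<le> (2 * card S) ^ n" for n
    using cayley_ball[OF assms(1-3) one_closed, of n] by auto
  have "order Q \<le> card (\<Union>n\<le>D. ?A n)"
    unfolding order_def by (rule card_mono[OF _ sub]) (use ball in auto)
  also have "\<dots> \<le> (\<Sum>n\<le>D. card (?A n))" by (rule card_UN_le) auto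
  also have "\<dots> \<le> (\<Sum>n\<le>D. (2 * card S) ^ n)" by (rule sum_mono) (use ball in auto)
  finally show ?thesis .
qed

lemma filtration_order_unbounded:
  fixes G (structure)
  assumes "group G" "filtration G M" "infinite (carrier G)"
  shows "finite {k. 0 < k \<and> order (G Mod M k) \<le> B}"
proof -
  interpret group G by fact
  obtain A where A: "A \<subseteq> carrier G" "finite A" "card A = Suc B"
    using assms(3) infinite_arbitrarily_large by metis
  have nor: "M k \<lhd> G" "finite (rcosets M k)" if "k > 0" for k
    using assms(2) that by (auto simp: filtration_def)
  define P where "P = {p \<in> A \<times> A. fst p \<noteq> snd p}"
  have ex: "\<exists>k>0. fst p \<otimes> inv (snd p) \<notin> M k" if "p \<in> P" for p
  proof (rule ccontr)
    assume "\<not> ?thesis"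
    then have "fst p \<otimes> inv (snd p) \<in> (\<Inter>k\<in>{0<..}. M k)" by blast
    moreover have "(\<Inter>k\<in>{0<..}. M k) = {\<one>}" using assms(2) unfolding filtration_def by blast
    ultimately have one: "fst p \<otimes> inv (snd p) = \<one>" by (metis singletonD)
    have c: "fst p \<in> carrier G" "snd p \<in> carrier G" using that A(1) by (auto simp: P_def)
    have "fst p = fst p \<otimes> inv (snd p) \<otimes> snd p" using c by (simp add: m_assoc)
    then have "fst p = snd p" using one c by simp
    then show False using that by (simp add: P_def)
  qed
  define \<kappa> where "\<kappa> p = (SOME k. k > (0::nat) \<and> fst p \<otimes> inv (snd p) \<notin> M k)" for p
  have \<kappa>: "\<kappa> p > 0 \<and> fst p \<otimes> inv (snd p) \<notin> M (\<kappa> p)" if "p \<in> P" for p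
    unfolding \<kappa>_def using ex[OF that] by (rule someI_ex)
  have finP: "finite P" unfolding P_def using A(2) by simp
  define L where "L = Max (insert 0 (\<kappa> ` P))"
  have L: "\<kappa> p \<le> L" if "p \<in> P" for p unfolding L_def using finP that by (intro Max_ge) simp_all
  have "order (G Mod M k) > B" if k: "k > 0" "k \<ge> L" for k
  proof -
    interpret N: normal "M k" G using nor k by auto
    have inj: "inj_on (\<lambda>a. M k #> a) A"
    proof (rule inj_onI, rule ccontr)
      fix a b assume ab: "a \<in> A" "b \<in> A" "M k #> a = M k #> b" "a \<noteq> b"
      have c: "a \<in> carrier G" "b \<in> carrier G" using ab A by auto
      have "a \<in> M k #> b" using rcos_self[OF c(1) N.subgroup_axioms] ab(3) by simp
      then obtain m where m: "m \<in> M k" "a = m \<otimes> b" unfolding r_coset_def by blast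
      then have mem: "a \<otimes> inv b \<in> M k" using c N.mem_carrier[OF m(1)] by (simp add: m_assoc)
      have p: "(a, b) \<in> P" using ab by (simp add: P_def)
      have "M k \<subseteq> M (\<kappa> (a, b))"
        using assms(2) conjunct1[OF \<kappa>[OF p]] order_trans[OF L[OF p] k(2)]
        unfolding filtration_def by blast
      then show False using \<kappa>[OF p] mem by (metis fst_conv snd_conv subsetD)
    qed
    have "(\<lambda>a. M k #> a) ` A \<subseteq> carrier (G Mod M k)"
      using A(1) by (auto simp: FactGroup_def RCOSETS_def)
    then have "card ((\<lambda>a. M k #> a) ` A) \<le> order (G Mod M k)"
      unfolding order_def using nor(2)[OF k(1)] by (intro card_mono) (auto simp: FactGroup_def)
    then show ?thesis using card_image[OF inj] A(3) by simp
  qed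
  then have "k \<le> L" if "0 < k" "order (G Mod M k) \<le> B" for k
    using that by (meson leD nle_le)
  then have "{k. 0 < k \<and> order (G Mod M k) \<le> B} \<subseteq> {..L}" by blast
  then show ?thesis by (rule finite_subset) simp
qed

lemma quotient_diam_unbounded:
  fixes G (structure)
  assumes "group G" "finite_generating_set G S" "filtration G M" "infinite (carrier G)"
  shows "finite {k. 0 < k \<and> quotient_diam G S (M k) \<le> D}"
proof -
  interpret group G by fact
  let ?B = "\<Sum>n\<le>D. (2 * card S) ^ n"
  have S: "finite S" "S \<subseteq> carrier G" "generate G S = carrier G"
    using assms(2) by (auto simp: finite_generating_set_def)
  have "order (G Mod M k) \<le> ?B" if k: "0 < k" "quotient_diam G S (M k) \<le> D" for k
  proof -
    have fin: "finite (carrier (G Mod M k))"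
      using assms(3) k by (auto simp: filtration_def FactGroup_def)
    interpret N: normal "M k" G using assms(3) k by (auto simp: filtration_def)
    interpret Q: group "G Mod M k" by (rule N.factorgroup_is_group)
    interpret h: group_hom G "G Mod M k" "\<lambda>a. M k #> a"
      by unfold_locales (rule N.r_coset_hom_Mod)
    let ?T = "quotient_gens G (M k) S"
    have T: "?T \<subseteq> carrier (G Mod M k)" "finite ?T"
      using S by (auto simp: quotient_gens_def)
    have "generate (G Mod M k) ?T = (\<lambda>a. M k #> a) ` carrier G"
      unfolding quotient_gens_def using h.generate_img[OF S(2)] S(3) by simp
    also have "\<dots> = carrier (G Mod M k)" by (auto simp: FactGroup_def RCOSETS_def)
    finally have gen: "generate (G Mod M k) ?T = carrier (G Mod M k)" .
    have "word_dist (G Mod M k) ?T \<one>\<^bsub>G Mod M k\<^esub> y \<le> D" if y: "y \<in> carrier (G Mod M k)" for y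
    proof -
      have "finite ((\<lambda>(x, y). quotient_dist G S (M k) x y) ` (carrier (G Mod M k) \<times> carrier (G Mod M k)))"
        using fin by blast
      moreover have "{quotient_dist G S (M k) x y | x y. x \<in> carrier (G Mod M k) \<and> y \<in> carrier (G Mod M k)}
        = (\<lambda>(x, y). quotient_dist G S (M k) x y) ` (carrier (G Mod M k) \<times> carrier (G Mod M k))"
        by auto
      ultimately have "quotient_dist G S (M k) \<one>\<^bsub>G Mod M k\<^esub> y \<le> quotient_diam G S (M k)"
        unfolding quotient_diam_def using y Q.one_closed by (intro Max_ge) auto
      then show ?thesis using k by (simp add: quotient_dist_def)
    qed
    then have "order (G Mod M k) \<le> (\<Sum>n\<le>D. (2 * card ?T) ^ n)"
      by (intro order_le_word_bound[OF Q.is_group T gen]) auto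
    also have "\<dots> \<le> ?B"
      using card_image_le[OF S(1)] by (intro sum_mono power_mono) (auto simp: quotient_gens_def)
    finally show ?thesis .
  qed
  then have "{k. 0 < k \<and> quotient_diam G S (M k) \<le> D} \<subseteq> {k. 0 < k \<and> order (G Mod M k) \<le> ?B}"
    by auto
  then show ?thesis
    by (rule finite_subset) (rule filtration_order_unbounded[OF assms(1,3,4)])
qed

lemma box_metric_iff_disjoint_union_metric:
  assumes "group G" "finite_generating_set G S" "filtration G M" "infinite (carrier G)"
  shows "box_metric G S M d \<longleftrightarrow> disjoint_union_metric G S M d"
proof -
  have "components_separated G M d" if d: "disjoint_union_metric G S M d"
    unfolding components_separated_def
  proof
    fix r :: real
    let ?F = "{k. 0 < k \<and> quotient_diam G S (M k) \<le> nat \<lfloor>r\<rfloor>}"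
    have "{(i, j). 0 < i \<and> 0 < j \<and> i \<noteq> j \<and>
        (\<exists>x\<in>carrier (G Mod M i). \<exists>y\<in>carrier (G Mod M j). d (i, x) (j, y) \<le> r)} \<subseteq> ?F \<times> ?F"
    proof clarify
      fix i j x y
      assume ij: "0 < i" "0 < j" "i \<noteq> j" "x \<in> carrier (G Mod M i)" "y \<in> carrier (G Mod M j)"
        "d (i, x) (j, y) \<le> r"
      then have "real (max (quotient_diam G S (M i)) (quotient_diam G S (M j))) \<le> d (i, x) (j, y)"
        using d unfolding disjoint_union_metric_def by blast
      then have "real (quotient_diam G S (M i)) \<le> r" "real (quotient_diam G S (M j)) \<le> r"
        using ij(6) by linarith+
      then show "i \<in> ?F \<and> j \<in> ?F" using ij(1,2) by (auto simp: le_nat_floor)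
    qed
    then show "finite {(i, j). 0 < i \<and> 0 < j \<and> i \<noteq> j \<and>
        (\<exists>x\<in>carrier (G Mod M i). \<exists>y\<in>carrier (G Mod M j). d (i, x) (j, y) \<le> r)}"
      by (rule finite_subset) (intro finite_cartesian_product quotient_diam_unbounded[OF assms])
  qed
  then show ?thesis by (auto simp: box_metric_def)
qed

end

theory Submission
  imports Defs
begin

text \<open>
  A coarse equivalence f from a box space X to a box space Y is bounded on edges, and so is the
  inverse correspondence between the net f(X) in Y and X. Components are connected by edges, and all but finitely many of them
  lie far away from the rest of their box space; hence for all but finitely many j the component
  \<open>Y\<^sub>j\<close> lies in the R-neighbourhood of the image of a single component \<open>X\<^sub>i\<close>, and f maps all of
  \<open>X\<^sub>i\<close> into \<open>Y\<^sub>j\<close>. Then the cardinality of \<open>Y\<^sub>j\<close> is at most that of \<open>X\<^sub>i\<close> times the size of an R-ball,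
  and lifting a path of \<open>Y\<^sub>j\<close> edge by edge shows that the diameter of \<open>X\<^sub>i\<close> is bounded linearly in
  that of \<open>Y\<^sub>j\<close>. Components of bounded cardinality cost only a change of the constant, because a
  component with more than one point has diameter at least 1.
\<close>

section \<open>Finite Cayley graphs\<close>

abbreviation cayley_adj :: "('a, 'm) monoid_scheme \<Rightarrow> 'a set \<Rightarrow> ('a \<times> 'a) set" where
  "cayley_adj Q U \<equiv> cayley_edges Q U \<union> (cayley_edges Q U)\<inverse>"

locale finite_cayley_graph = group Q for Q (structure) +
  fixes U
  assumes finite_carrier: "finite (carrier Q)"
    and gens_subset: "U \<subseteq> carrier Q"
    and generate_gens: "generate Q U = carrier Q"
begin

lemma word_dist_le: "(x, y) \<in> cayley_adj Q U ^^ n \<Longrightarrow> word_dist Q U x y \<le> n"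
  unfolding word_dist_def by (rule Least_le)

lemma relpow_word_dist:
  assumes "x \<in> carrier Q" "y \<in> carrier Q"
  shows "(x, y) \<in> cayley_adj Q U ^^ word_dist Q U x y"
proof -
  have "(x, x \<otimes> (inv x \<otimes> y)) \<in> (cayley_adj Q U)\<^sup>*"
    using assms generate_gens by (intro cayley_connected[OF is_group gens_subset]) auto
  moreover have "x \<otimes> (inv x \<otimes> y) = y" using assms by (simp flip: m_assoc)
  ultimately have "\<exists>n. (x, y) \<in> cayley_adj Q U ^^ n" using rtrancl_imp_relpow by fastforce
  then show ?thesis unfolding word_dist_def by (rule LeastI_ex)
qed

lemma cayley_adj_carrier: "(x, y) \<in> cayley_adj Q U \<Longrightarrow> x \<in> carrier Q \<and> y \<in> carrier Q"
  using gens_subset by (auto simp: cayley_edges_def)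

lemma word_dist_adj: "(x, y) \<in> cayley_adj Q U \<Longrightarrow> word_dist Q U x y \<le> 1"
  by (rule word_dist_le) simp

lemma word_dist_pos:
  assumes "x \<in> carrier Q" "y \<in> carrier Q" "x \<noteq> y"
  shows "1 \<le> word_dist Q U x y"
proof (rule ccontr)
  assume "\<not> ?thesis"
  then have "word_dist Q U x y = 0" by simp
  then show False using relpow_word_dist[OF assms(1,2)] assms(3) by simp
qed

text \<open>Each step of a path has at most \<open>2 * card U\<close> choices. The bound depends
  only on the number of generators and the radius, so it serves all components of a box space at
  once.\<close>

lemma card_word_ball_le:
  assumes "x \<in> carrier Q"
  shows "card {y \<in> carrier Q. word_dist Q U x y \<le> r} \<le> (\<Sum>n\<le>r. (2 * card U) ^ n)"
proof -
  let ?A = "\<lambda>n. {y. (x, y) \<in> cayley_adj Q U ^^ n}"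
  have ball: "finite (?A n)" "card (?A n) \<le> (2 * card U) ^ n" for n
    using cayley_ball[OF is_group gens_subset finite_subset[OF gens_subset finite_carrier] assms, of n]
    by auto
  have "{y \<in> carrier Q. word_dist Q U x y \<le> r} \<subseteq> (\<Union>n\<le>r. ?A n)"
    using relpow_word_dist[OF assms] by auto
  then have "card {y \<in> carrier Q. word_dist Q U x y \<le> r} \<le> card (\<Union>n\<le>r. ?A n)"
    using ball by (intro card_mono) auto
  also have "\<dots> \<le> (\<Sum>n\<le>r. card (?A n))" by (rule card_UN_le) auto
  also have "\<dots> \<le> (\<Sum>n\<le>r. (2 * card U) ^ n)" by (rule sum_mono) (use ball in auto)
  finally show ?thesis .
qed

end

lemma finite_cayley_graph_quotient:
  fixes G (structure)
  assumes "finite_generating_set G S" "N \<lhd> G" "finite (rcosets N)"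
  shows "finite_cayley_graph (G Mod N) (quotient_gens G N S)"
proof -
  interpret N: normal N G by fact
  interpret Q: group "G Mod N" by (rule N.factorgroup_is_group)
  interpret h: group_hom G "G Mod N" "\<lambda>a. N #> a"
    by unfold_locales (rule N.r_coset_hom_Mod)
  have S: "S \<subseteq> carrier G" "generate G S = carrier G"
    using assms(1) by (auto simp: finite_generating_set_def)
  show ?thesis
  proof
    show "finite (carrier (G Mod N))" using assms(3) by (simp add: FactGroup_def)
    show "quotient_gens G N S \<subseteq> carrier (G Mod N)" using S by (auto simp: quotient_gens_def)
    have "generate (G Mod N) (quotient_gens G N S) = (\<lambda>a. N #> a) ` carrier G"
      unfolding quotient_gens_def using h.generate_img[OF S(1)] S(2) by simp
    then show "generate (G Mod N) (quotient_gens G N S) = carrier (G Mod N)"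
      by (auto simp: FactGroup_def RCOSETS_def)
  qed
qed

lemma filtration_finite_cayley_graph:
  assumes "finite_generating_set G S" "filtration G M" "k > 0"
  shows "finite_cayley_graph (G Mod M k) (quotient_gens G (M k) S)"
  using assms(2,3) by (intro finite_cayley_graph_quotient[OF assms(1)]) (simp_all add: filtration_def)

section \<open>Diameters of finite quotients\<close>

lemma quotient_dists_eq_image:
  "{quotient_dist G S N x y | x y. x \<in> carrier (G Mod N) \<and> y \<in> carrier (G Mod N)}
    = (\<lambda>(x, y). quotient_dist G S N x y) ` (carrier (G Mod N) \<times> carrier (G Mod N))"
  by auto

lemma quotient_dist_le_diam:
  assumes "finite (carrier (G Mod N))" "x \<in> carrier (G Mod N)" "y \<in> carrier (G Mod N)"
  shows "quotient_dist G S N x y \<le> quotient_diam G S N"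
  unfolding quotient_diam_def quotient_dists_eq_image using assms by (intro Max_ge) auto

lemma quotient_diam_attained:
  assumes "finite (carrier (G Mod N))" "carrier (G Mod N) \<noteq> {}"
  obtains x y where "x \<in> carrier (G Mod N)" "y \<in> carrier (G Mod N)"
    "quotient_diam G S N = quotient_dist G S N x y"
proof -
  have "quotient_diam G S N \<in>
      (\<lambda>(x, y). quotient_dist G S N x y) ` (carrier (G Mod N) \<times> carrier (G Mod N))"
    unfolding quotient_diam_def quotient_dists_eq_image using assms by (intro Max_in) auto
  then show ?thesis using that by auto
qed

text \<open>Some element differs from the identity, and distinct points are at distance at least 1.
  The bound later absorbs additive constants into multiples of the diameter.\<close>

lemma quotient_diam_pos:
  assumes "finite_cayley_graph (G Mod N) (quotient_gens G N S)" "order (G Mod N) \<noteq> 1"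
  shows "1 \<le> quotient_diam G S N"
proof -
  interpret finite_cayley_graph "G Mod N" "quotient_gens G N S" by fact
  have "carrier (G Mod N) \<noteq> {\<one>\<^bsub>G Mod N\<^esub>}" using assms(2) by (auto simp: order_def)
  then obtain x where x: "x \<in> carrier (G Mod N)" "x \<noteq> \<one>\<^bsub>G Mod N\<^esub>" using one_closed by blast
  have "1 \<le> quotient_dist G S N x \<one>\<^bsub>G Mod N\<^esub>"
    unfolding quotient_dist_def by (rule word_dist_pos[OF x(1) one_closed x(2)])
  also have "\<dots> \<le> quotient_diam G S N"
    by (rule quotient_dist_le_diam[OF finite_carrier x(1) one_closed])
  finally show ?thesis .
qed

section \<open>Coarse embeddings and isolated components\<close>

text \<open>Without a bound there are points \<open>p n\<close> with \<open>u (p n) > n\<close> and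
  \<open>v (p n)\<close> at most \<open>r\<close>, against the hypothesis. This turns the sequential
  definition of a coarse embedding into uniform control.\<close>

lemma bounded_if_seq_at_top:
  fixes u v :: "'c \<Rightarrow> real"
  assumes "\<And>p. (\<And>n. p n \<in> P) \<Longrightarrow> filterlim (\<lambda>n. u (p n)) at_top sequentially \<Longrightarrow>
      filterlim (\<lambda>n. v (p n)) at_top sequentially"
  shows "\<exists>s. \<forall>p\<in>P. v p \<le> r \<longrightarrow> u p \<le> s"
proof (rule ccontr)
  assume "\<not> ?thesis"
  then have "\<forall>n::nat. \<exists>p\<in>P. v p \<le> r \<and> u p > real n" by (meson not_le)
  then obtain p where p: "\<And>n. p n \<in> P" "\<And>n. v (p n) \<le> r" "\<And>n. u (p n) > real n" by metis
  have "filterlim (\<lambda>n. u (p n)) at_top sequentially"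
    by (rule filterlim_at_top_mono[OF filterlim_real_sequentially])
      (simp add: p(3) less_imp_le)
  then have "eventually (\<lambda>n. v (p n) \<ge> r + 1) sequentially"
    using assms p(1) by (auto simp: filterlim_at_top)
  then obtain n where "v (p n) \<ge> r + 1" by (auto simp: eventually_sequentially)
  then show False using p(2)[of n] by linarith
qed

text \<open>Uses the sequential condition from right to left: if image distances diverge, so do the
  distances in \<open>X\<close>.\<close>

lemma coarse_embedding_bounded:
  assumes "coarse_embedding X dX Y dY f"
  shows "\<exists>s. \<forall>x\<in>X. \<forall>y\<in>X. dX x y \<le> r \<longrightarrow> dY (f x) (f y) \<le> s"
proof -
  have "\<exists>s. \<forall>p\<in>X \<times> X. dX (fst p) (snd p) \<le> r \<longrightarrow> dY (f (fst p)) (f (snd p)) \<le> s"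
  proof (rule bounded_if_seq_at_top)
    fix p :: "nat \<Rightarrow> _"
    assume "\<And>n. p n \<in> X \<times> X"
      and lim: "filterlim (\<lambda>n. dY (f (fst (p n))) (f (snd (p n)))) at_top sequentially"
    then have "\<forall>n. fst (p n) \<in> X" "\<forall>n. snd (p n) \<in> X" by (auto simp: mem_Times_iff)
    with lim assms show "filterlim (\<lambda>n. dX (fst (p n)) (snd (p n))) at_top sequentially"
      unfolding coarse_embedding_def by metis
  qed
  then show ?thesis by auto
qed

lemma coarse_embedding_proper:
  assumes "coarse_embedding X dX Y dY f"
  shows "\<exists>s. \<forall>x\<in>X. \<forall>y\<in>X. dY (f x) (f y) \<le> r \<longrightarrow> dX x y \<le> s"
proof -
  have "\<exists>s. \<forall>p\<in>X \<times> X. dY (f (fst p)) (f (snd p)) \<le> r \<longrightarrow> dX (fst p) (snd p) \<le> s"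
  proof (rule bounded_if_seq_at_top)
    fix p :: "nat \<Rightarrow> _"
    assume "\<And>n. p n \<in> X \<times> X"
      and lim: "filterlim (\<lambda>n. dX (fst (p n)) (snd (p n))) at_top sequentially"
    then have "\<forall>n. fst (p n) \<in> X" "\<forall>n. snd (p n) \<in> X" by (auto simp: mem_Times_iff)
    with lim assms show "filterlim (\<lambda>n. dY (f (fst (p n))) (f (snd (p n)))) at_top sequentially"
      unfolding coarse_embedding_def by metis
  qed
  then show ?thesis by auto
qed

text \<open>\<open>F\<close> consists of the first indices of the finitely many pairs of distinct
  components that have points at distance at most \<open>r\<close>.\<close>

lemma components_isolated:
  assumes "components_separated G M d"
  shows "\<exists>F. finite F \<and> (\<forall>p\<in>box_points G M. \<forall>q\<in>box_points G M.
    d p q \<le> r \<longrightarrow> fst p \<notin> F \<longrightarrow> fst q = fst p)"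
proof -
  define P where "P = {(i, j). 0 < i \<and> 0 < j \<and> i \<noteq> j \<and>
        (\<exists>x\<in>carrier (G Mod M i). \<exists>y\<in>carrier (G Mod M j). d (i, x) (j, y) \<le> r)}"
  have "finite P" using assms unfolding P_def components_separated_def by blast
  moreover have "fst q = fst p"
    if pq: "p \<in> box_points G M" "q \<in> box_points G M" "d p q \<le> r" "fst p \<notin> fst ` P" for p q
  proof (rule ccontr)
    assume "fst q \<noteq> fst p"
    then have "(fst p, fst q) \<in> P" using pq(1-3) by (fastforce simp: P_def box_points_def)
    then show False using pq(4) by force
  qed
  ultimately show ?thesis by (intro exI[of _ "fst ` P"]) auto
qed

lemma box_points_iff: "(k, x) \<in> box_points G M \<longleftrightarrow> 0 < k \<and> x \<in> carrier (G Mod M k)"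
  by (auto simp: box_points_def)

lemma box_metric_component:
  assumes "box_metric G S M d" "0 < k" "x \<in> carrier (G Mod M k)" "y \<in> carrier (G Mod M k)"
  shows "d (k, x) (k, y) = real (quotient_dist G S (M k) x y)"
  using assms by (simp add: box_metric_def disjoint_union_metric_def)

section \<open>Coarse equivalences of box spaces\<close>

text \<open>The covering half will bound the order of component \<open>j\<close> by that of
  component \<open>i\<close>, and the other half compares diameters; together they carry the
  inequality of property D from \<open>i\<close> to \<open>j\<close>.\<close>

lemma coarse_equivalence_components:
  fixes G :: "('a, 'm) monoid_scheme" and H :: "('b, 'n) monoid_scheme"
  assumes G: "finite_generating_set G S" "filtration G M" "box_metric G S M dG"
    and H: "finite_generating_set H T" "filtration H N" "box_metric H T N dH"
    and f: "coarse_equivalence (box_points G M) dG (box_points H N) dH f"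
  obtains F r s where "finite F"
    "\<And>j. 0 < j \<Longrightarrow> j \<notin> F \<Longrightarrow> \<exists>i>0.
      (\<forall>y\<in>carrier (H Mod N j). \<exists>x\<in>carrier (G Mod M i). \<exists>z\<in>carrier (H Mod N j).
          f (i, x) = (j, z) \<and> quotient_dist H T (N j) z y \<le> r) \<and>
      real (quotient_diam G S (M i)) \<le> s * (real (quotient_diam H T (N j)) + 1)"
proof -
  let ?X = "box_points G M" and ?Y = "box_points H N"
  interpret X: Metric_space ?X dG
    using G(3) by (simp add: box_metric_def disjoint_union_metric_def)
  interpret Y: Metric_space ?Y dH
    using H(3) by (simp add: box_metric_def disjoint_union_metric_def)
  have emb: "coarse_embedding ?X dG ?Y dH f"
    using f by (simp add: coarse_equivalence_def)
  have fY: "f x \<in> ?Y" if "x \<in> ?X" for x using emb that by (auto simp: coarse_embedding_def)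
  obtain R where R: "R \<ge> 0" "\<And>y. y \<in> ?Y \<Longrightarrow> \<exists>x\<in>?X. dH (f x) y \<le> R"
    using f by (auto simp: coarse_equivalence_def)
  \<comment> \<open>The scale 1 is the length of an edge.\<close>
  obtain L where L: "\<And>x y. x \<in> ?X \<Longrightarrow> y \<in> ?X \<Longrightarrow> dG x y \<le> 1 \<Longrightarrow> dH (f x) (f y) \<le> L"
    using coarse_embedding_bounded[OF emb] by metis
  \<comment> \<open>Two image points that lie within \<open>R\<close> of the two ends of an edge of
    \<open>Y\<close> are at most \<open>2 * R + 1\<close> apart.\<close>
  obtain s where s: "\<And>x y. x \<in> ?X \<Longrightarrow> y \<in> ?X \<Longrightarrow> dH (f x) (f y) \<le> 2 * R + 1 \<Longrightarrow> dG x y \<le> s"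
    using coarse_embedding_proper[OF emb] by metis
  obtain FX where FX: "finite FX" "\<And>p q. p \<in> ?X \<Longrightarrow> q \<in> ?X \<Longrightarrow> dG p q \<le> s \<Longrightarrow> fst p \<notin> FX \<Longrightarrow> fst q = fst p"
    using components_isolated G(3) unfolding box_metric_def by metis
  \<comment> \<open>Scale \<open>R\<close> puts an image point close to a component into that
    component; scale \<open>L\<close> keeps the image of an edge inside one component.\<close>
  obtain FY where FY: "finite FY" "\<And>p q. p \<in> ?Y \<Longrightarrow> q \<in> ?Y \<Longrightarrow> dH p q \<le> max R L \<Longrightarrow> fst p \<notin> FY \<Longrightarrow> fst q = fst p"
    using components_isolated H(3) unfolding box_metric_def by metis
  have cX: "finite_cayley_graph (G Mod M i) (quotient_gens G (M i) S)" if "i > 0" for i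
    by (rule filtration_finite_cayley_graph[OF G(1,2) that])
  have cY: "finite_cayley_graph (H Mod N j) (quotient_gens H (N j) T)" if "j > 0" for j
    by (rule filtration_finite_cayley_graph[OF H(1,2) that])
  \<comment> \<open>Besides the poorly isolated components of \<open>Y\<close>, those met by the
    image of a poorly isolated component of \<open>X\<close> are discarded. They are finitely many
    because components are finite.\<close>
  define F where "F = FY \<union> (\<lambda>p. fst (f p)) ` (SIGMA i:FX \<inter> {0<..}. carrier (G Mod M i))"
  have "finite F"
    unfolding F_def using FX(1) FY(1) finite_cayley_graph.finite_carrier[OF cX]
    by (intro finite_UnI finite_imageI finite_SigmaI) auto
  moreover have "\<exists>i>0.
      (\<forall>y\<in>carrier (H Mod N j). \<exists>x\<in>carrier (G Mod M i). \<exists>z\<in>carrier (H Mod N j).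
          f (i, x) = (j, z) \<and> quotient_dist H T (N j) z y \<le> nat \<lfloor>R\<rfloor>) \<and>
      real (quotient_diam G S (M i)) \<le> s * (real (quotient_diam H T (N j)) + 1)"
    if j: "0 < j" "j \<notin> F" for j
  proof -
    interpret Qj: finite_cayley_graph "H Mod N j" "quotient_gens H (N j) T" by (rule cY[OF j(1)])
    let ?E = "cayley_adj (H Mod N j) (quotient_gens H (N j) T)"
    have net: "\<exists>x\<in>?X. fst (f x) = j \<and> dH (f x) (j, y) \<le> R" if y: "y \<in> carrier (H Mod N j)" for y
    proof -
      have yY: "(j, y) \<in> ?Y" using j(1) y by (simp add: box_points_iff)
      then obtain x where x: "x \<in> ?X" "dH (f x) (j, y) \<le> R" using R(2) by blast
      then have "dH (j, y) (f x) \<le> max R L" by (simp add: Y.commute)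
      then have "fst (f x) = j"
        using FY(2)[OF yY fY[OF x(1)]] j(2) by (auto simp: F_def)
      then show ?thesis using x by blast
    qed
    have near: "fst x' = fst x"
      if "x \<in> ?X" "x' \<in> ?X" "dG x x' \<le> s" "fst (f x) = j" for x x'
    proof -
      \<comment> \<open>Otherwise \<open>j = fst (f x)\<close> would be one of the indices put into
        \<open>F\<close>.\<close>
      have "fst x \<notin> FX"
        using j(2) that(1,4) by (force simp: F_def box_points_def)
      then show ?thesis using FX(2) that by blast
    qed
    \<comment> \<open>Path lifting: each vertex of the path is replaced by a point of
      \<open>X\<close> whose image is within \<open>R\<close> of it. Consecutive choices are at most
      \<open>s\<close> apart, hence in the same component of \<open>X\<close>.\<close>
    have lift: "\<exists>x'\<in>?X. fst x' = fst x \<and> fst (f x') = j \<and> dH (f x') (j, y) \<le> R \<and> dG x x' \<le> s * real n"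
      if "x \<in> ?X" "f x = (j, y0)" "(y0, y) \<in> ?E ^^ n" for x y0 y n
      using that(3)
    proof (induction n arbitrary: y)
      case 0
      have fx: "f x \<in> ?Y" by (rule fY[OF that(1)])
      have "dH (f x) (f x) = 0" "dG x x = 0" using fx that(1) by (auto simp: Y.zero X.zero)
      then show ?case using 0 that(1,2) R(1) by auto
    next
      case (Suc n)
      then obtain w where w: "(y0, w) \<in> ?E ^^ n" "(w, y) \<in> ?E" by auto
      obtain x' where x': "x' \<in> ?X" "fst x' = fst x" "fst (f x') = j" "dH (f x') (j, w) \<le> R"
          "dG x x' \<le> s * real n"
        using Suc.IH[OF w(1)] by blast
      have c: "w \<in> carrier (H Mod N j)" "y \<in> carrier (H Mod N j)"
        using Qj.cayley_adj_carrier[OF w(2)] by auto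
      obtain x'' where x'': "x'' \<in> ?X" "fst (f x'') = j" "dH (f x'') (j, y) \<le> R" using net[OF c(2)] by blast
      have "dH (j, w) (j, y) \<le> 1"
        using Qj.word_dist_adj[OF w(2)] box_metric_component[OF H(3) j(1) c]
        by (simp add: quotient_dist_def)
      moreover have "dH (f x') (f x'') \<le> dH (f x') (j, w) + dH (j, w) (f x'')"
        "dH (j, w) (f x'') \<le> dH (j, w) (j, y) + dH (f x'') (j, y)"
        using Y.triangle[OF fY[OF x'(1)], of "(j, w)" "f x''"]
          Y.triangle[of "(j, w)" "(j, y)" "f x''"] fY[OF x''(1)] c j(1)
        by (auto simp: box_points_iff Y.commute)
      ultimately have "dG x' x'' \<le> s" using x'(4) x''(3) by (intro s x'(1) x''(1)) linarith
      moreover have "dG x x'' \<le> dG x x' + dG x' x''" by (rule X.triangle[OF that(1) x'(1) x''(1)])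
      ultimately show ?case
        using x' x'' near[OF x'(1) x''(1) _ x'(3)]
        by (intro bexI[of _ x'']) (auto simp: algebra_simps)
    qed
    \<comment> \<open>Any point that \<open>f\<close> sends to component \<open>j\<close> can select
      \<open>i\<close>; the identity merely supplies a point of \<open>j\<close> to start
      from.\<close>
    obtain x0 where x0: "x0 \<in> ?X" "fst (f x0) = j" using net[OF Qj.one_closed] by blast
    define i where "i = fst x0"
    have i: "i > 0" "snd x0 \<in> carrier (G Mod M i)" using x0(1) by (auto simp: i_def box_points_def)
    have fj: "\<exists>z\<in>carrier (H Mod N j). f p = (j, z)" if "p \<in> ?X" "fst (f p) = j" for p
      using fY[OF that(1)] that(2) by (auto simp: box_points_def)
    interpret Qi: finite_cayley_graph "G Mod M i" "quotient_gens G (M i) S" by (rule cX[OF i(1)])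
    \<comment> \<open>Along a path from \<open>x0\<close> the image jumps by at most
      \<open>L\<close> per edge, so it cannot leave the isolated component \<open>j\<close>.\<close>
    have reach: "fst (f (i, x)) = j"
      if "(snd x0, x) \<in> cayley_adj (G Mod M i) (quotient_gens G (M i) S) ^^ n" for n x
      using that
    proof (induction n arbitrary: x)
      case 0
      then show ?case using x0(2) by (cases x0) (simp add: i_def)
    next
      case (Suc n)
      then obtain w where w: "(snd x0, w) \<in> cayley_adj (G Mod M i) (quotient_gens G (M i) S) ^^ n"
          "(w, x) \<in> cayley_adj (G Mod M i) (quotient_gens G (M i) S)" by auto
      have c: "w \<in> carrier (G Mod M i)" "x \<in> carrier (G Mod M i)"
        using Qi.cayley_adj_carrier[OF w(2)] by auto
      then have X: "(i, w) \<in> ?X" "(i, x) \<in> ?X" using i(1) by (auto simp: box_points_iff)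
      have "dG (i, w) (i, x) \<le> 1"
        using Qi.word_dist_adj[OF w(2)] box_metric_component[OF G(3) i(1) c]
        by (simp add: quotient_dist_def)
      then have "dH (f (i, w)) (f (i, x)) \<le> max R L" using L[OF X] by simp
      then show ?case
        using FY(2)[OF fY[OF X(1)] fY[OF X(2)]] Suc.IH[OF w(1)] j(2) by (auto simp: F_def)
    qed
    have into: "\<exists>z\<in>carrier (H Mod N j). f (i, x) = (j, z)" if "x \<in> carrier (G Mod M i)" for x
      using fj reach[OF Qi.relpow_word_dist[OF i(2) that]] that i(1) by (simp add: box_points_iff)
    \<comment> \<open>Lifting a path that starts at \<open>f x0\<close> keeps the endpoint in
      component \<open>i\<close>, which \<open>net\<close> alone would not give.\<close>
    have onto: "\<exists>x\<in>carrier (G Mod M i). \<exists>z\<in>carrier (H Mod N j).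
          f (i, x) = (j, z) \<and> quotient_dist H T (N j) z y \<le> nat \<lfloor>R\<rfloor>"
      if y: "y \<in> carrier (H Mod N j)" for y
    proof -
      obtain y0 where y0: "y0 \<in> carrier (H Mod N j)" "f x0 = (j, y0)" using fj[OF x0] by blast
      obtain x' where x': "x' \<in> ?X" "fst x' = i" "fst (f x') = j" "dH (f x') (j, y) \<le> R"
        using lift[OF x0(1) y0(2) Qj.relpow_word_dist[OF y0(1) y]] unfolding i_def by blast
      obtain z where z: "z \<in> carrier (H Mod N j)" "f x' = (j, z)" using fj[OF x'(1,3)] by blast
      have "real (quotient_dist H T (N j) z y) \<le> R"
        using x'(4) z box_metric_component[OF H(3) j(1) z(1) y] by simp
      then have "quotient_dist H T (N j) z y \<le> nat \<lfloor>R\<rfloor>" by (simp add: le_nat_floor)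
      moreover have "x' = (i, snd x')" "snd x' \<in> carrier (G Mod M i)"
        using x'(1,2) by (auto simp: box_points_def)
      ultimately show ?thesis using z by metis
    qed
    \<comment> \<open>For a diametral pair, the path between the two images is lifted from
      \<open>(i, x)\<close>. The lift need not end at \<open>(i, y)\<close>; the remaining gap of at
      most \<open>s\<close> accounts for the \<open>+ 1\<close>.\<close>
    obtain x y where xy: "x \<in> carrier (G Mod M i)" "y \<in> carrier (G Mod M i)"
        "quotient_diam G S (M i) = quotient_dist G S (M i) x y"
      using quotient_diam_attained[OF Qi.finite_carrier] Qi.one_closed by blast
    have X: "(i, x) \<in> ?X" "(i, y) \<in> ?X" using i(1) xy by (auto simp: box_points_iff)
    obtain a b where a: "a \<in> carrier (H Mod N j)" "f (i, x) = (j, a)"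
      and b: "b \<in> carrier (H Mod N j)" "f (i, y) = (j, b)"
      using into xy by metis
    let ?n = "quotient_dist H T (N j) a b"
    obtain x' where x': "x' \<in> ?X" "dH (f x') (j, b) \<le> R" "dG (i, x) x' \<le> s * real ?n"
      using lift[OF X(1) a(2) Qj.relpow_word_dist[OF a(1) b(1)]] unfolding quotient_dist_def by blast
    have near': "dG x' (i, y) \<le> s" using x'(2) R(1) b(2) by (intro s x'(1) X(2)) simp
    \<comment> \<open>The choice of \<open>s\<close> fixed no sign, but here it bounds a
      distance.\<close>
    then have "s \<ge> 0" using X.nonneg[of x' "(i, y)"] by linarith
    have "real (quotient_diam G S (M i)) = dG (i, x) (i, y)"
      using xy box_metric_component[OF G(3) i(1)] by simp
    also have "\<dots> \<le> s * (real ?n + 1)"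
      using X.triangle[OF X(1) x'(1) X(2)] near' x'(3) by (simp add: algebra_simps)
    also have "\<dots> \<le> s * (real (quotient_diam H T (N j)) + 1)"
      using quotient_dist_le_diam[OF Qj.finite_carrier a(1) b(1), of T] \<open>s \<ge> 0\<close>
      by (intro mult_left_mono) auto
    finally show ?thesis using onto i(1) by blast
  qed
  ultimately show thesis by (rule that)
qed

section \<open>Cardinality bounds and the final constants\<close>

text \<open>The balls of radius \<open>r\<close> around the points \<open>g x\<close> cover the
  quotient. Their sizes are bounded uniformly because passing to the quotient does not increase the
  number of generators.\<close>

lemma card_component_le:
  assumes "finite_generating_set H T"
    and "finite_cayley_graph (H Mod B) (quotient_gens H B T)" "finite A"
    and cover: "\<And>y. y \<in> carrier (H Mod B) \<Longrightarrow>
      \<exists>x\<in>A. g x \<in> carrier (H Mod B) \<and> quotient_dist H T B (g x) y \<le> r"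
  shows "order (H Mod B) \<le> card A * (\<Sum>n\<le>r. (2 * card T) ^ n)"
proof -
  interpret finite_cayley_graph "H Mod B" "quotient_gens H B T" by fact
  let ?C = "\<Sum>n\<le>r. (2 * card T) ^ n"
  \<comment> \<open>The ball estimate holds only for centres in the carrier, so other values of
    \<open>g\<close> are dropped.\<close>
  let ?A = "{x \<in> A. g x \<in> carrier (H Mod B)}"
  let ?B = "\<lambda>x. {y \<in> carrier (H Mod B). quotient_dist H T B (g x) y \<le> r}"
  have "finite T" using assms(1) by (simp add: finite_generating_set_def)
  then have T: "card (quotient_gens H B T) \<le> card T"
    unfolding quotient_gens_def by (rule card_image_le)
  have ball: "card (?B x) \<le> ?C" if "g x \<in> carrier (H Mod B)" for x
  proof -
    have "card (?B x) \<le> (\<Sum>n\<le>r. (2 * card (quotient_gens H B T)) ^ n)"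
      unfolding quotient_dist_def by (rule card_word_ball_le[OF that])
    also have "\<dots> \<le> ?C" using T by (intro sum_mono power_mono) auto
    finally show ?thesis .
  qed
  have "carrier (H Mod B) \<subseteq> (\<Union>x\<in>?A. ?B x)" using cover by blast
  then have "order (H Mod B) \<le> card (\<Union>x\<in>?A. ?B x)"
    unfolding order_def using assms(3) finite_carrier by (intro card_mono) auto
  also have "\<dots> \<le> (\<Sum>x\<in>?A. card (?B x))" using assms(3) by (intro card_UN_le) auto
  also have "\<dots> \<le> card ?A * ?C" using sum_bounded_above[of ?A "\<lambda>x. card (?B x)" ?C] ball by simp
  also have "\<dots> \<le> card A * ?C" using assms(3) by (intro mult_right_mono card_mono) auto
  finally show ?thesis .
qed

lemma property_D_if_large_components:
  assumes H: "finite_generating_set H T" "filtration H N" and "0 < \<alpha>" "0 < K"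
    and large: "\<And>k. 0 < k \<Longrightarrow> order (H Mod N k) > B \<Longrightarrow>
      real (quotient_diam H T (N k)) \<ge> K * real (order (H Mod N k)) powr \<alpha>"
  shows "property_D \<alpha> H T N"
  unfolding property_D_def
proof (intro exI conjI allI impI)
  \<comment> \<open>The second entry makes the required lower bound at most 1 for orders up to
    \<open>B\<close>; \<open>Suc\<close> keeps the entry positive when \<open>B = 0\<close>.\<close>
  let ?K = "min K (1 / real (Suc B) powr \<alpha>)"
  show "0 < ?K" using assms(4) by simp
  fix k :: nat
  assume k: "0 < k" "order (H Mod N k) \<noteq> 1"
  show "?K * real (order (H Mod N k)) powr \<alpha> \<le> real (quotient_diam H T (N k))"
  proof (cases "order (H Mod N k) > B")
    case True
    have "?K * real (order (H Mod N k)) powr \<alpha> \<le> K * real (order (H Mod N k)) powr \<alpha>"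
      by (intro mult_right_mono) auto
    then show ?thesis using large[OF k(1) True] by linarith
  next
    case False
    have "?K * real (order (H Mod N k)) powr \<alpha> \<le> 1 / real (Suc B) powr \<alpha> * real (Suc B) powr \<alpha>"
      using False assms(3) by (intro mult_mono powr_mono2) auto
    also have "\<dots> = 1" by simp
    also have "\<dots> \<le> real (quotient_diam H T (N k))"
      using quotient_diam_pos[OF filtration_finite_cayley_graph[OF H k(1)] k(2)] by simp
    finally show ?thesis .
  qed
qed

theorem lemma6:
  fixes G :: "('a, 'm) monoid_scheme" and H :: "('b, 'n) monoid_scheme"
    and S :: "'a set" and T :: "'b set"
    and M :: "nat \<Rightarrow> 'a set" and N :: "nat \<Rightarrow> 'b set"
    and dG :: "nat \<times> 'a set \<Rightarrow> nat \<times> 'a set \<Rightarrow> real"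
    and dH :: "nat \<times> 'b set \<Rightarrow> nat \<times> 'b set \<Rightarrow> real"
    and \<alpha> :: real
  assumes "0 < \<alpha>" and "\<alpha> \<le> 1"
    and "group G" and "finite_generating_set G S" and "residually_finite G" and "filtration G M"
    and "group H" and "finite_generating_set H T" and "residually_finite H" and "filtration H N"
    and "box_metric G S M dG" and "box_metric H T N dH"
    and "coarsely_equivalent (box_points G M) dG (box_points H N) dH"
    and "property_D \<alpha> G S M"
  shows "property_D \<alpha> H T N"
proof -
  obtain f where f: "coarse_equivalence (box_points G M) dG (box_points H N) dH f"
    using assms(13) by (auto simp: coarsely_equivalent_def)
  obtain F r s where F: "finite F" and comp:
    "\<And>j. 0 < j \<Longrightarrow> j \<notin> F \<Longrightarrow> \<exists>i>0.
      (\<forall>y\<in>carrier (H Mod N j). \<exists>x\<in>carrier (G Mod M i). \<exists>z\<in>carrier (H Mod N j).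
          f (i, x) = (j, z) \<and> quotient_dist H T (N j) z y \<le> r) \<and>
      real (quotient_diam G S (M i)) \<le> s * (real (quotient_diam H T (N j)) + 1)"
    using coarse_equivalence_components[OF assms(4,6,11,8,10,12) f] by blast
  obtain K where K: "K > 0" "\<And>k. k > 0 \<Longrightarrow> order (G Mod M k) \<noteq> 1 \<Longrightarrow>
      K * real (order (G Mod M k)) powr \<alpha> \<le> real (quotient_diam G S (M k))"
    using assms(14) by (auto simp: property_D_def)
  define C where "C = (\<Sum>n\<le>r. (2 * card T) ^ n)"
  \<comment> \<open>\<open>s\<close> comes without a sign, and the final constant divides by this
    number.\<close>
  define s' where "s' = max s 1"
  \<comment> \<open>An order above \<open>B\<close> puts \<open>j\<close> outside \<open>F\<close>
    and ensures that component \<open>j\<close> has more than one point, and component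
    \<open>i\<close> as well.\<close>
  define B where "B = Max (insert 1 (insert C ((\<lambda>j. order (H Mod N j)) ` F)))"
  have B: "1 \<le> B" "C \<le> B" "\<And>j. j \<in> F \<Longrightarrow> order (H Mod N j) \<le> B"
    unfolding B_def by (rule Max_ge; use F in simp)+
  \<comment> \<open>The summand for \<open>n = 0\<close> is 1, even if \<open>T\<close> is
    empty.\<close>
  have C: "C > 0" unfolding C_def by (simp add: sum.atMost_shift)
  show ?thesis
  proof (rule property_D_if_large_components[OF assms(8,10,1)])
    have pos: "0 < 2 * s' * real C powr \<alpha>" using C by (simp add: s'_def)
    then show "0 < K / (2 * s' * real C powr \<alpha>)" using K(1) by simp
    fix j :: nat
    assume j: "0 < j" "B < order (H Mod N j)"
    interpret Qj: finite_cayley_graph "H Mod N j" "quotient_gens H (N j) T"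
      by (rule filtration_finite_cayley_graph[OF assms(8,10) j(1)])
    obtain i where i: "i > 0"
      "\<And>y. y \<in> carrier (H Mod N j) \<Longrightarrow> \<exists>x\<in>carrier (G Mod M i). \<exists>z\<in>carrier (H Mod N j).
          f (i, x) = (j, z) \<and> quotient_dist H T (N j) z y \<le> r"
      "real (quotient_diam G S (M i)) \<le> s * (real (quotient_diam H T (N j)) + 1)"
      using comp[OF j(1)] B(3) j(2) by (meson not_less)
    interpret Qi: finite_cayley_graph "G Mod M i" "quotient_gens G (M i) S"
      by (rule filtration_finite_cayley_graph[OF assms(4,6) i(1)])
    let ?D = "real (quotient_diam H T (N j))"
    have ord: "order (H Mod N j) \<le> order (G Mod M i) * C"
      unfolding C_def order_def[of "G Mod M i"]
      by (rule card_component_le[OF assms(8) Qj.finite_cayley_graph_axioms Qi.finite_carrier,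
            where g = "\<lambda>x. snd (f (i, x))"]) (metis i(2) snd_conv)
    \<comment> \<open>A one-point component \<open>i\<close> would force the order of component
      \<open>j\<close> to be at most \<open>C\<close>, hence at most \<open>B\<close>.\<close>
    have "order (G Mod M i) \<noteq> 1" using ord B(2) j(2) by (metis leD mult_1 order_trans)
    then have "K * real (order (G Mod M i)) powr \<alpha> \<le> s * (?D + 1)"
      using order_trans[OF K(2)[OF i(1)] i(3)] by simp
    also have "\<dots> \<le> s' * (?D + 1)" by (intro mult_right_mono) (auto simp: s'_def)
    \<comment> \<open>Component \<open>j\<close> has diameter at least 1, so the additive 1 is at
      most \<open>?D\<close>.\<close>
    also have "\<dots> \<le> s' * (2 * ?D)"
      using quotient_diam_pos[OF Qj.finite_cayley_graph_axioms] j(2) B(1)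
      by (intro mult_left_mono) (auto simp: s'_def)
    finally have diam: "K * real (order (G Mod M i)) powr \<alpha> \<le> 2 * s' * ?D" by simp
    have "real (order (H Mod N j)) \<le> real (order (G Mod M i)) * real C"
      using ord by (metis of_nat_le_iff of_nat_mult)
    then have "real (order (H Mod N j)) powr \<alpha> \<le> (real (order (G Mod M i)) * real C) powr \<alpha>"
      using assms(1) by (intro powr_mono2) auto
    then have "K * real (order (H Mod N j)) powr \<alpha>
        \<le> (K * real (order (G Mod M i)) powr \<alpha>) * real C powr \<alpha>"
      using K(1) by (simp add: powr_mult)
    also have "\<dots> \<le> 2 * s' * ?D * real C powr \<alpha>" by (intro mult_right_mono diam) simp
    finally show "K / (2 * s' * real C powr \<alpha>) * real (order (H Mod N j)) powr \<alpha> \<le> ?D"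
      using pos by (simp add: pos_divide_le_eq mult_ac)
  qed
qed

end
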